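(* Let $a\ge3$ be an integer and $\widetilde{\mathcal Z}=\widetilde R_{a,1}\cup\widetilde R_{1,a}$. Then for all $\alpha\in(0,1)$, $$a-2\alpha-9a\alpha^{3/2}\le\widetilde I(\alpha,\alpha,\widetilde{\mathcal Z})\le a-2\alpha.$$
   Context: $\widetilde R_{a,b}=[0,a]\times[0,b]$. A Euclidean zero-set is a closed $\widetilde{\mathcal Z}\subseteq[0,\infty)^2$ such that $(a,b)\in\widetilde{\mathcal Z}$ implies $\widetilde R_{a,b}\subseteq\widetilde{\mathcal Z}$, and $\widetilde{\mathcal Z}$ is the closure of $\widetilde{\mathcal Z}\cap(0,\infty)^2$. For Borel $A\subseteq[0,\infty)^2$, $\widetilde{\mathrm{row}}(x,A)$ (resp. $\widetilde{\mathrm{col}}(x,A)$) is the 1-dimensional Lebesgue measure of $A$ intersected with the horizontal (resp. vertical) line through $x$. For left-continuous nonincreasing $f,g:[0,\infty)\to[0,\infty)$ of compact support, $\widetilde{\mathcal T}(A)=A\cup\{(u,v):(\widetilde{\mathrm{row}}((u,v),A)+f(v),\widetilde{\mathrm{col}}((u,v),A)+g(u))\notin\widetilde{\mathcal Z}\}$; $A$ E-spans for $(\widetilde{\mathcal Z},f,g)$ if $\bigcup_n\widetilde{\mathcal T}^n(A)=[0,\infty)^2$. For bounded $\widetilde{\mathcal Z}$ and $(\alpha,\beta)\in[0,1]^2$: $\widetilde I(\alpha,\beta,\widetilde{\mathcal Z})=\inf\{\mathrm{area}(A)+(1-\alpha)\int_0^\infty f+(1-\beta)\int_0^\infty g\}$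 over all $(A,f,g)$ with $A$ compact E-spanning for $(\widetilde{\mathcal Z},f,g)$. *)

theory Defs
  imports "HOL-Analysis.Analysis"
begin

type_synonym pt = "real \<times> real"

definition quadrant :: "pt set" where
  "quadrant = {0..} \<times> {0..}"

definition ERect :: "real \<Rightarrow> real \<Rightarrow> pt set" where
  "ERect a b = {0..a} \<times> {0..b}"

definition E_zero_set :: "pt set \<Rightarrow> bool" where
  "E_zero_set Z \<longleftrightarrow> closed Z \<and> Z \<subseteq> quadrant
     \<and> (\<forall>a b. (a, b) \<in> Z \<longrightarrow> ERect a b \<subseteq> Z)
     \<and> Z = closure (Z \<inter> ({0<..} \<times> {0<..}))"

definition Erow :: "pt \<Rightarrow> pt set \<Rightarrow> ennreal" where
  "Erow x A = emeasure lborel {s::real. (s, snd x) \<in> A}"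

definition Ecol :: "pt \<Rightarrow> pt set \<Rightarrow> ennreal" where
  "Ecol x A = emeasure lborel {t::real. (fst x, t) \<in> A}"

definition admissible_fun :: "(real \<Rightarrow> real) \<Rightarrow> bool" where
  "admissible_fun f \<longleftrightarrow>
     (\<forall>x\<ge>0. f x \<ge> 0)
     \<and> (\<forall>x y. 0 \<le> x \<longrightarrow> x \<le> y \<longrightarrow> f y \<le> f x)
     \<and> (\<forall>x>0. (f \<longlongrightarrow> f x) (at_left x))
     \<and> (\<exists>M. \<forall>x\<ge>M. f x = 0)"

text \<open>The pair (r,c) of extended reals lies in Z iff both are finite and
  (r + f v, c + g u) is in Z.\<close>
definition ET :: "pt set \<Rightarrow> (real \<Rightarrow> real) \<Rightarrow> (real \<Rightarrow> real) \<Rightarrow> pt set \<Rightarrow> pt set" where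
  "ET Z f g A = A \<union> {(u, v). 0 \<le> u \<and> 0 \<le> v \<and>
      \<not> (Erow (u, v) A < \<infinity> \<and> Ecol (u, v) A < \<infinity> \<and>
         (enn2real (Erow (u, v) A) + f v, enn2real (Ecol (u, v) A) + g u) \<in> Z)}"

definition E_spans :: "pt set \<Rightarrow> pt set \<Rightarrow> (real \<Rightarrow> real) \<Rightarrow> (real \<Rightarrow> real) \<Rightarrow> bool" where
  "E_spans A Z f g \<longleftrightarrow> (\<Union>n. (ET Z f g ^^ n) A) = quadrant"

definition E_I :: "real \<Rightarrow> real \<Rightarrow> pt set \<Rightarrow> real" where
  "E_I \<alpha> \<beta> Z = Inf {measure lborel A + (1 - \<alpha>) * integral {0..} f + (1 - \<beta>) * integral {0..} g
      | A f g. compact A \<and> A \<subseteq> quadrant \<and> admissible_fun f \<and> admissible_fun g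
               \<and> E_spans A Z f g}"

end

theory Submission
  imports Defs
begin

text \<open>
  Lower bound. The zero-set contains both \<open>R\<^sub>a\<^sub>,\<^sub>1\<close> and \<open>R\<^sub>1\<^sub>,\<^sub>a\<close>, so a spanning triple spans for each of
  these rectangles. For a rectangle \<open>p \<times> q\<close> the dynamics may be enlarged so that it fills whole rows
  \<open>H\<close> and columns \<open>W\<close>. Filling a set of rows of measure \<open>d\<close> lowers the potential \<open>(p - |W|)(q - |H|)\<close>
  by \<open>(p - |W|) d\<close> and consumes at least as much of \<open>A\<close> and \<open>f\<close> on those rows; the same holds for
  columns. Stopping when \<open>|H| = q\<close> or \<open>|W| = p\<close> gives
  \<open>p q \<le> area A + \<integral>\<^sub>H min f p + \<integral>\<^sub>W min g q\<close>. Adding the cases \<open>(a, 1)\<close> and \<open>(1, a)\<close> yields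
  \<open>2 a \<le> 2 area A + \<integral>f + \<integral>g + 2\<close>; a convex combination with \<open>a \<le> area A + \<integral>f + \<integral>g\<close> bounds the
  cost below by \<open>a - 2 \<alpha>\<close> when \<open>\<alpha> \<le> 1/2\<close>, and for \<open>\<alpha> > 1/2\<close> the claimed bound is negative.

  Upper bound. For \<open>k > 1\<close> take \<open>f = g = k\<close> on \<open>[0, k]\<close> and \<open>A\<close> the \<open>a - 2\<close> diagonal squares of side \<open>k\<close>
  that follow \<open>[0, k]\<^sup>2\<close>; everything is infected after three steps, and \<open>k\<close> tends to \<open>1\<close>.
\<close>

subsection \<open>Filling whole rows and columns\<close>

text \<open>Columns get no counterpart: they are row sections of the reflected set, so facts about
  rows transfer to columns through \<open>prod.swap\<close>.\<close>

definition row_section :: "pt set \<Rightarrow> real \<Rightarrow> real set" where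
  "row_section A v = {s. (s, v) \<in> A}"

definition lines :: "real set \<Rightarrow> real set \<Rightarrow> pt set" where
  "lines W H = {x. fst x \<in> W \<or> snd x \<in> H}"

text \<open>The invariant of the filling process: the remaining potential plus the resources
  consumed so far stays at least \<open>p * q\<close>. Charging a row at most \<open>p\<close> of
  \<open>f\<close>, and a column at most \<open>q\<close> of \<open>g\<close>, is what later makes
  it profitable to combine two rectangles.\<close>

definition line_state ::
  "real \<Rightarrow> real \<Rightarrow> pt set \<Rightarrow> (real \<Rightarrow> real) \<Rightarrow> (real \<Rightarrow> real) \<Rightarrow> real set \<Rightarrow> real set \<Rightarrow> bool" where
  "line_state p q A f g W H \<longleftrightarrow>
     W \<in> sets borel \<and> H \<in> sets borel \<and> W \<subseteq> {0..} \<and> H \<subseteq> {0..} \<and>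
     emeasure lborel W \<le> ennreal p \<and> emeasure lborel H \<le> ennreal q \<and>
     ennreal (p * q) \<le> ennreal ((p - measure lborel W) * (q - measure lborel H))
       + (emeasure lborel (A \<inter> lines W H)
       + ((\<integral>\<^sup>+x\<in>H. ennreal (min (f x) p) \<partial>lborel) + (\<integral>\<^sup>+x\<in>W. ennreal (min (g x) q) \<partial>lborel)))"

section \<open>Horizontal sections and reflection in the diagonal\<close>

lemma row_section_borel [measurable]: "A \<in> sets borel \<Longrightarrow> row_section A v \<in> sets borel"
proof -
  assume "A \<in> sets borel"
  then have "(\<lambda>s. (s, v)) -` A \<inter> space borel \<in> sets borel"
    by (intro measurable_sets[of _ borel borel]) simp_all
  then show ?thesis by (simp add: row_section_def vimage_def)
qed

lemma lines_borel [measurable]: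
  "W \<in> sets borel \<Longrightarrow> H \<in> sets borel \<Longrightarrow> lines W H \<in> sets borel"
proof -
  assume "W \<in> sets borel" "H \<in> sets borel"
  moreover have "lines W H = (W \<times> UNIV) \<union> (UNIV \<times> H)" by (auto simp: lines_def)
  ultimately show ?thesis by (auto intro!: sets.Un borel_Times)
qed

text \<open>Tonelli's theorem, slicing the plane by horizontal lines.\<close>

lemma emeasure_lborel_rows:
  assumes "X \<in> sets borel"
  shows "emeasure lborel X = (\<integral>\<^sup>+v. emeasure lborel (row_section X v) \<partial>lborel)"
    and "(\<lambda>v. emeasure lborel (row_section X v)) \<in> borel_measurable borel"
proof -
  have X: "X \<in> sets (lborel \<Otimes>\<^sub>M (lborel :: real measure))"
    using assms unfolding lborel_prod by simp
  have eq: "(\<lambda>x. (x, v)) -` X = row_section X v" for v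
    by (auto simp: row_section_def)
  show "emeasure lborel X = (\<integral>\<^sup>+v. emeasure lborel (row_section X v) \<partial>lborel)"
    using lborel_pair.emeasure_pair_measure_alt2[OF X] by (simp add: eq lborel_prod)
  show "(\<lambda>v. emeasure lborel (row_section X v)) \<in> borel_measurable borel"
    using lborel_pair.measurable_emeasure_Pair2[OF X] by (simp add: eq)
qed

lemma borel_swap: "X \<in> sets borel \<Longrightarrow> (prod.swap -` X :: pt set) \<in> sets borel"
  using measurable_sets[of "prod.swap :: pt \<Rightarrow> pt" borel borel X]
  by (simp add: borel_measurable_continuous_onI continuous_on_swap)

lemma emeasure_lborel_swap:
  assumes "(X :: pt set) \<in> sets borel"
  shows "emeasure lborel (prod.swap -` X) = emeasure lborel X"
proof -
  let ?L = "lborel \<Otimes>\<^sub>M (lborel :: real measure)"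
  have X: "X \<in> sets ?L" using assms unfolding lborel_prod by simp
  have sw: "(\<lambda>(x, y). (y, x)) = (prod.swap :: pt \<Rightarrow> pt)" by auto
  have "emeasure ?L X = emeasure (distr ?L ?L (\<lambda>(x, y). (y, x))) X"
    using arg_cong[OF lborel_pair.distr_pair_swap] .
  also have "\<dots> = emeasure ?L ((\<lambda>(x, y). (y, x)) -` X \<inter> space ?L)"
    using X by (intro emeasure_distr measurable_pair_swap')
  finally show ?thesis by (simp add: lborel_prod sw)
qed

text \<open>Reflection exchanges \<open>p\<close>, \<open>f\<close>, \<open>H\<close> with
  \<open>q\<close>, \<open>g\<close>, \<open>W\<close>, so only the growth of rows has to be
  treated.\<close>

lemma line_state_swap:
  assumes "A \<in> sets borel"
  shows "line_state p q A f g W H \<longleftrightarrow> line_state q p (prod.swap -` A) g f H W"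
proof -
  have eq: "prod.swap -` A \<inter> lines H W = prod.swap -` (A \<inter> lines W H)" by (auto simp: lines_def)
  have "emeasure lborel (prod.swap -` A \<inter> lines H W) = emeasure lborel (A \<inter> lines W H)"
    if "W \<in> sets borel" "H \<in> sets borel"
    unfolding eq by (intro emeasure_lborel_swap sets.Int assms lines_borel that)
  moreover have "(q - h) * (p - w) = (p - w) * (q - h)" "q * p = p * q" for h w by simp_all
  ultimately show ?thesis
    unfolding line_state_def
    by (simp only: add.commute[of "\<integral>\<^sup>+x\<in>H. _ x \<partial>lborel"] cong: conj_cong) blast
qed

text \<open>On each row of \<open>D\<close>, \<open>fill\<close> makes \<open>f\<close> and the part
  of \<open>A\<close> outside the columns \<open>W\<close> cover at least \<open>p - w\<close>.
  Integration over \<open>D\<close> pays for the loss \<open>(p - w) * d\<close> of potential; since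
  \<open>D\<close> misses \<open>H\<close>, nothing is charged twice.\<close>

lemma line_state_grow_rows:
  assumes st: "line_state p q A f g W H" and A [measurable]: "A \<in> sets borel"
    and f [measurable]: "f \<in> borel_measurable borel" and f0: "\<And>x. f x \<ge> 0"
    and pq: "p \<ge> 0" "q \<ge> 0"
    and D [measurable]: "D \<in> sets borel" "D \<subseteq> {0..}" "D \<inter> H = {}"
    and Dq: "emeasure lborel (H \<union> D) \<le> ennreal q"
    and fill: "\<And>v. v \<in> D \<Longrightarrow> ennreal p \<le> emeasure lborel (row_section A v \<union> W) + ennreal (f v)"
  shows "line_state p q A f g W (H \<union> D)"
proof -
  define w h d where "w = measure lborel W" and "h = measure lborel H" and "d = measure lborel D"
  have W [measurable]: "W \<in> sets borel" and H [measurable]: "H \<in> sets borel"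
    and Wp: "emeasure lborel W \<le> ennreal p" and H0: "W \<subseteq> {0..}" "H \<subseteq> {0..}"
    and main: "ennreal (p * q) \<le> ennreal ((p - w) * (q - h))
       + (emeasure lborel (A \<inter> lines W H)
       + ((\<integral>\<^sup>+x\<in>H. ennreal (min (f x) p) \<partial>lborel) + (\<integral>\<^sup>+x\<in>W. ennreal (min (g x) q) \<partial>lborel)))"
    using st unfolding line_state_def w_def h_def by blast+
  have Ww: "emeasure lborel W = ennreal w"
    using Wp unfolding w_def by (intro emeasure_eq_ennreal_measure) (auto simp: top_unique)
  have wp: "w \<le> p" using Wp pq by (simp add: Ww)
  have sum: "emeasure lborel H + emeasure lborel D = emeasure lborel (H \<union> D)"
    using D by (intro plus_emeasure) auto
  have fin: "emeasure lborel (H \<union> D) \<noteq> \<infinity>" using Dq by (auto simp: top_unique)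
  then have "emeasure lborel H \<noteq> top" "emeasure lborel D \<noteq> top"
    unfolding sum[symmetric] by simp_all
  then have Hh: "emeasure lborel H = ennreal h" and Dd: "emeasure lborel D = ennreal d"
    unfolding h_def d_def by (simp_all add: emeasure_eq_ennreal_measure)
  have hd0: "h \<ge> 0" "d \<ge> 0" "w \<ge> 0" by (simp_all add: h_def d_def w_def)
  have HD: "emeasure lborel (H \<union> D) = ennreal (h + d)"
    using hd0 by (simp add: sum[symmetric] Hh Dd)
  have hdq: "h + d \<le> q" using Dq pq by (simp add: HD)
  have mHD: "measure lborel (H \<union> D) = h + d"
    unfolding measure_def HD using hd0 by (intro enn2real_ennreal) simp
  \<comment> \<open>The newly charged part of \<open>A\<close>: points over \<open>W\<close> are
    already counted in \<open>A \<inter> lines W H\<close>.\<close>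
  define N where "N = A \<inter> ((- W) \<times> D)"
  have N [measurable]: "N \<in> sets borel" unfolding N_def by (intro sets.Int A borel_Times) auto
  have secN: "row_section N v = (if v \<in> D then row_section A v - W else {})" for v
    by (auto simp: row_section_def N_def)
  have pt: "ennreal (p - w) * indicator D v
      \<le> emeasure lborel (row_section N v) + ennreal (min (f v) p) * indicator D v" for v
  proof (cases "v \<in> D")
    case True
    let ?e = "emeasure lborel (row_section A v - W)"
    have "emeasure lborel (row_section A v \<union> W) \<le> ?e + ennreal w"
      using emeasure_subadditive[of "row_section A v - W" lborel W] by (simp add: Ww)
    then have *: "ennreal p \<le> ?e + ennreal w + ennreal (f v)"
      by (rule order_trans[OF fill[OF True] add_right_mono])
    have "ennreal (p - w) \<le> ?e + ennreal (min (f v) p)"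
    proof (cases ?e)
      case (real r)
      then have "p \<le> r + w + f v"
        using * hd0 f0[of v] by (simp flip: ennreal_plus)
      \<comment> \<open>The cap is harmless: when \<open>f v\<close> exceeds \<open>p\<close>, the
        value \<open>p\<close> alone covers \<open>p - w\<close>.\<close>
      then have "p - w \<le> r + min (f v) p" using real hd0 by linarith
      then show ?thesis using real f0[of v] pq by (simp flip: ennreal_plus)
    qed simp
    then show ?thesis using True by (simp add: secN)
  qed simp
  have "ennreal ((p - w) * d) = (\<integral>\<^sup>+v. ennreal (p - w) * indicator D v \<partial>lborel)"
    using wp hd0 by (simp add: nn_integral_cmult_indicator Dd ennreal_mult)
  also have "\<dots> \<le> (\<integral>\<^sup>+v. emeasure lborel (row_section N v)
                  + ennreal (min (f v) p) * indicator D v \<partial>lborel)"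
    by (intro nn_integral_mono pt)
  also have "\<dots> = emeasure lborel N + (\<integral>\<^sup>+x\<in>D. ennreal (min (f x) p) \<partial>lborel)"
    using emeasure_lborel_rows[OF N] by (subst nn_integral_add) auto
  finally have gain: "ennreal ((p - w) * d) \<le> \<dots>" .
  have area: "emeasure lborel (A \<inter> lines W H) + emeasure lborel N = emeasure lborel (A \<inter> lines W (H \<union> D))"
  proof -
    have "A \<inter> lines W (H \<union> D) = A \<inter> lines W H \<union> N" "A \<inter> lines W H \<inter> N = {}"
      using D by (auto simp: lines_def N_def)
    then show ?thesis by (simp add: plus_emeasure)
  qed
  have int: "(\<integral>\<^sup>+x\<in>H \<union> D. ennreal (min (f x) p) \<partial>lborel)
     = (\<integral>\<^sup>+x\<in>H. ennreal (min (f x) p) \<partial>lborel) + (\<integral>\<^sup>+x\<in>D. ennreal (min (f x) p) \<partial>lborel)"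
    using D by (intro nn_integral_disjoint_pair) auto
  have "(p - w) * (q - h) = (p - w) * (q - (h + d)) + (p - w) * d" by (simp add: algebra_simps)
  then have "ennreal ((p - w) * (q - h)) = ennreal ((p - w) * (q - (h + d))) + ennreal ((p - w) * d)"
    using wp hdq hd0 by (simp flip: ennreal_plus)
  also have "\<dots> \<le> ennreal ((p - w) * (q - (h + d)))
      + (emeasure lborel N + (\<integral>\<^sup>+x\<in>D. ennreal (min (f x) p) \<partial>lborel))"
    by (intro add_left_mono gain)
  finally have step: "ennreal ((p - w) * (q - h)) \<le> \<dots>" .
  have "ennreal (p * q) \<le> ennreal ((p - w) * (q - (h + d)))
      + (emeasure lborel N + (\<integral>\<^sup>+x\<in>D. ennreal (min (f x) p) \<partial>lborel))
      + (emeasure lborel (A \<inter> lines W H)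
       + ((\<integral>\<^sup>+x\<in>H. ennreal (min (f x) p) \<partial>lborel) + (\<integral>\<^sup>+x\<in>W. ennreal (min (g x) q) \<partial>lborel)))"
    by (rule order_trans[OF main add_right_mono[OF step]])
  moreover have "x + (n + i) + (b + (j + k)) = x + ((b + n) + ((j + i) + k))" for x n i b j k :: ennreal
    by (simp only: ac_simps)
  ultimately have "ennreal (p * q) \<le> ennreal ((p - w) * (q - (h + d)))
       + (emeasure lborel (A \<inter> lines W (H \<union> D))
       + ((\<integral>\<^sup>+x\<in>H \<union> D. ennreal (min (f x) p) \<partial>lborel) + (\<integral>\<^sup>+x\<in>W. ennreal (min (g x) q) \<partial>lborel)))"
    by (simp only: area int)
  then show ?thesis
    using Wp Dq H0 D by (simp add: line_state_def mHD w_def)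
qed

text \<open>The measure of \<open>D \<inter> {0..t}\<close> is 1-Lipschitz in \<open>t\<close> and
  starts at 0, so the intermediate value theorem cuts off an initial piece of the right size. This
  allows a batch of rows to be trimmed until the total is exactly \<open>q\<close>.\<close>

lemma borel_subset_of_measure:
  fixes D :: "real set"
  assumes D [measurable]: "D \<in> sets borel" and c: "0 \<le> c" "ennreal c \<le> emeasure lborel D" and "D \<subseteq> {0..}"
  obtains D' where "D' \<subseteq> D" "D' \<in> sets borel" "emeasure lborel D' = ennreal c"
proof (cases "ennreal c = emeasure lborel D")
  case True
  then show ?thesis using that[of D] D by simp
next
  case False
  then have c': "ennreal c < emeasure lborel D" using c by simp
  define \<phi> where "\<phi> t = measure lborel (D \<inter> {0..t})" for t
  have em: "emeasure lborel (D \<inter> {0..t}) = ennreal (\<phi> t)" for t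
  proof -
    have "emeasure lborel (D \<inter> {0..t}) \<le> emeasure lborel {0..t}" by (intro emeasure_mono) auto
    also have "\<dots> < \<infinity>" by (cases "0 \<le> t") auto
    finally show ?thesis unfolding \<phi>_def by (intro emeasure_eq_ennreal_measure) auto
  qed
  have step: "\<phi> s \<le> \<phi> t \<and> \<phi> t \<le> \<phi> s + (t - s)" if "s \<le> t" for s t
  proof -
    have nn: "0 \<le> \<phi> r" for r by (simp add: \<phi>_def)
    have "emeasure lborel (D \<inter> {0..s}) \<le> emeasure lborel (D \<inter> {0..t})"
      using that by (intro emeasure_mono) auto
    moreover have "emeasure lborel (D \<inter> {0..t}) \<le> emeasure lborel (D \<inter> {0..s} \<union> {s..t})"
      by (intro emeasure_mono) auto
    moreover have "\<dots> \<le> emeasure lborel (D \<inter> {0..s}) + emeasure lborel {s..t}"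
      by (intro emeasure_subadditive) auto
    ultimately have "ennreal (\<phi> s) \<le> ennreal (\<phi> t)" "ennreal (\<phi> t) \<le> ennreal (\<phi> s) + ennreal (t - s)"
      using that by (auto simp: em)
    then show ?thesis using that nn by (simp flip: ennreal_plus)
  qed
  \<comment> \<open>For unbounded \<open>D\<close> the full measure may only be approached as the
    truncation grows. The strict inequality \<open>c'\<close> still yields a finite
    \<open>n\<close>, even when \<open>D\<close> has infinite measure.\<close>
  have "(SUP n. emeasure lborel (D \<inter> {0..real n})) = emeasure lborel (\<Union>n. D \<inter> {0..real n})"
    by (intro SUP_emeasure_incseq) (auto simp: incseq_def)
  also have "(\<Union>n. D \<inter> {0..real n}) = D"
  proof
    show "D \<subseteq> (\<Union>n. D \<inter> {0..real n})"
    proof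
      fix x assume "x \<in> D"
      moreover obtain n where "x \<le> real n" using real_arch_simple by blast
      ultimately show "x \<in> (\<Union>n. D \<inter> {0..real n})" using assms(4) by auto
    qed
  qed auto
  finally have "ennreal c < (SUP n. emeasure lborel (D \<inter> {0..real n}))" using c' by simp
  then obtain n :: nat where "ennreal c < emeasure lborel (D \<inter> {0..real n})"
    unfolding less_SUP_iff by blast
  then have n: "c \<le> \<phi> n" using c by (simp add: em ennreal_less_iff)
  have "continuous_on UNIV \<phi>"
  proof (rule lipschitz_on_continuous_on[of 1], rule lipschitz_onI)
    show "dist (\<phi> s) (\<phi> t) \<le> 1 * dist s t" for s t
      using step[of s t] step[of t s] by (cases "s \<le> t") (auto simp: dist_real_def)
  qed simp
  then have cont: "continuous_on {0..real n} \<phi>" by (rule continuous_on_subset) simp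
  have "\<phi> 0 \<le> c"
  proof -
    have "emeasure lborel (D \<inter> {0..0}) \<le> emeasure lborel {0::real}" by (intro emeasure_mono) auto
    then have "ennreal (\<phi> 0) \<le> 0" unfolding em by simp
    then show ?thesis using c by (simp add: ennreal_eq_0_iff)
  qed
  from IVT'[OF this n _ cont] obtain t where "\<phi> t = c" by auto
  then show ?thesis using that[of "D \<inter> {0..t}"] em[of t] by simp
qed

text \<open>What is left of \<open>line_state\<close> once the potential is zero. The measure bounds
  on \<open>W\<close> and \<open>H\<close> are kept because the rectangles with a side of length 1
  later need one of these sets to have measure at most 1.\<close>

definition rectangle_bound ::
  "real \<Rightarrow> real \<Rightarrow> pt set \<Rightarrow> (real \<Rightarrow> real) \<Rightarrow> (real \<Rightarrow> real) \<Rightarrow> bool" where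
  "rectangle_bound p q A f g \<longleftrightarrow> (\<exists>W H. W \<in> sets borel \<and> H \<in> sets borel \<and> W \<subseteq> {0..} \<and> H \<subseteq> {0..} \<and>
     emeasure lborel W \<le> ennreal p \<and> emeasure lborel H \<le> ennreal q \<and>
     ennreal (p * q) \<le> emeasure lborel A
       + ((\<integral>\<^sup>+x\<in>H. ennreal (min (f x) p) \<partial>lborel) + (\<integral>\<^sup>+x\<in>W. ennreal (min (g x) q) \<partial>lborel)))"

text \<open>Strictness matches the closed rectangle: a row total of exactly \<open>p\<close> does
  not leave \<open>ERect p q\<close>.\<close>

definition full_rows :: "real \<Rightarrow> pt set \<Rightarrow> (real \<Rightarrow> real) \<Rightarrow> real set \<Rightarrow> real set" where
  "full_rows p A f W =
     {v. 0 \<le> v \<and> ennreal p < emeasure lborel (row_section A v \<union> W) + ennreal (f v)}"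

lemma rectangle_bound_swap:
  assumes "A \<in> sets borel"
  shows "rectangle_bound p q A f g \<longleftrightarrow> rectangle_bound q p (prod.swap -` A) g f"
proof -
  have *: "rectangle_bound q p (prod.swap -` A) g f"
    if rb: "rectangle_bound p q A f g" and A: "A \<in> sets borel" for p q A f g
  proof -
    obtain W H where "W \<in> sets borel" "H \<in> sets borel" "W \<subseteq> {0..}" "H \<subseteq> {0..}"
      "emeasure lborel W \<le> ennreal p" "emeasure lborel H \<le> ennreal q"
      and "ennreal (p * q) \<le> emeasure lborel A
       + ((\<integral>\<^sup>+x\<in>H. ennreal (min (f x) p) \<partial>lborel) + (\<integral>\<^sup>+x\<in>W. ennreal (min (g x) q) \<partial>lborel))"
      using rb unfolding rectangle_bound_def by (elim exE conjE) (rule that)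
    moreover from this(7) have "ennreal (q * p) \<le> emeasure lborel (prod.swap -` A)
       + ((\<integral>\<^sup>+x\<in>W. ennreal (min (g x) q) \<partial>lborel) + (\<integral>\<^sup>+x\<in>H. ennreal (min (f x) p) \<partial>lborel))"
      unfolding emeasure_lborel_swap[OF A]
      by (simp only: mult.commute[of q p] add.commute[of "\<integral>\<^sup>+x\<in>W. ennreal (min (g x) q) \<partial>lborel"])
    ultimately show ?thesis
      unfolding rectangle_bound_def by (intro exI[of _ H] exI[of _ W] conjI) assumption+
  qed
  have id: "prod.swap -` prod.swap -` A = A" by auto
  show ?thesis
    using *[OF _ assms, of p q f g] *[OF _ borel_swap[OF assms], of q p g f] unfolding id by (rule iffI)
qed

lemma line_state_full:
  assumes "line_state p q A f g W H" "A \<in> sets borel" "measure lborel H = q"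
  shows "rectangle_bound p q A f g"
proof -
  note st = assms(1)[unfolded line_state_def assms(3)]
  have "emeasure lborel (A \<inter> lines W H) \<le> emeasure lborel A"
    using assms(2) by (intro emeasure_mono) auto
  moreover have "ennreal (p * q) \<le> emeasure lborel (A \<inter> lines W H)
       + ((\<integral>\<^sup>+x\<in>H. ennreal (min (f x) p) \<partial>lborel) + (\<integral>\<^sup>+x\<in>W. ennreal (min (g x) q) \<partial>lborel))"
    using st by simp
  ultimately have "ennreal (p * q) \<le> emeasure lborel A
       + ((\<integral>\<^sup>+x\<in>H. ennreal (min (f x) p) \<partial>lborel) + (\<integral>\<^sup>+x\<in>W. ennreal (min (g x) q) \<partial>lborel))"
    by (meson add_right_mono order_trans)
  then show ?thesis using st unfolding rectangle_bound_def by blast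
qed

text \<open>If all of \<open>D\<close> fits, \<open>line_state_grow_rows\<close> applies to
  \<open>D - H\<close>. Otherwise a subset of \<open>D - H\<close> of measure \<open>q - h\<close>
  fills the rows exactly up to \<open>q\<close>; the potential vanishes and the bound excluded by
  \<open>nb\<close> follows.\<close>

lemma grow_rows_or_bound:
  assumes st: "line_state p q A f g W H" and A [measurable]: "A \<in> sets borel"
    and f: "f \<in> borel_measurable borel" "\<And>x. f x \<ge> 0"
    and pq: "p \<ge> 0" "q \<ge> 0"
    and D [measurable]: "D \<in> sets borel" "D \<subseteq> {0..}"
    and fill: "\<And>v. v \<in> D \<Longrightarrow> ennreal p \<le> emeasure lborel (row_section A v \<union> W) + ennreal (f v)"
    and nb: "\<not> rectangle_bound p q A f g"
  shows "line_state p q A f g W (H \<union> D)"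
proof (cases "emeasure lborel (H \<union> D) \<le> ennreal q")
  case True
  have "line_state p q A f g W (H \<union> (D - H))"
    using True D fill st by (intro line_state_grow_rows assms) (auto simp: line_state_def)
  then show ?thesis by simp
next
  case False
  have H [measurable]: "H \<in> sets borel" and Hq: "emeasure lborel H \<le> ennreal q"
    using st unfolding line_state_def by blast+
  define h where "h = measure lborel H"
  have Hh: "emeasure lborel H = ennreal h"
    using Hq unfolding h_def by (intro emeasure_eq_ennreal_measure) (auto simp: top_unique)
  have h: "0 \<le> h" "h \<le> q" using Hq pq unfolding Hh by (simp_all add: h_def)
  have "ennreal h + ennreal (q - h) \<le> emeasure lborel (H \<union> (D - H))"
    using False h by (simp flip: ennreal_plus)
  also have "\<dots> = ennreal h + emeasure lborel (D - H)"
    unfolding Hh[symmetric] by (intro plus_emeasure[symmetric]) auto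
  finally have "ennreal (q - h) \<le> emeasure lborel (D - H)"
    by (simp add: ennreal_add_left_cancel_le)
  then obtain D' where D': "D' \<subseteq> D - H" "D' \<in> sets borel" "emeasure lborel D' = ennreal (q - h)"
    using borel_subset_of_measure[of "D - H" "q - h"] D h by auto
  have "emeasure lborel (H \<union> D') = emeasure lborel H + emeasure lborel D'"
    using D' by (intro plus_emeasure[symmetric]) auto
  also have "\<dots> = ennreal q" unfolding Hh D'(3) using h by (simp flip: ennreal_plus)
  finally have q: "emeasure lborel (H \<union> D') = ennreal q" .
  have "line_state p q A f g W (H \<union> D')"
    using D' D fill q by (intro line_state_grow_rows assms) auto
  moreover have "measure lborel (H \<union> D') = q" using q pq by (simp add: measure_def)
  ultimately show ?thesis using line_state_full A nb by blast
qed

lemma full_rows_borel: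
  assumes "A \<in> sets borel" and W: "W \<in> sets borel" and [measurable]: "f \<in> borel_measurable borel"
  shows "full_rows p A f W \<in> sets borel"
proof -
  \<comment> \<open>The horizontal sections of this planar set are the sets
    \<open>row_section A v \<union> W\<close>.\<close>
  have "A \<union> W \<times> UNIV \<in> sets borel" using assms by (intro sets.Un borel_Times) auto
  from emeasure_lborel_rows(2)[OF this]
  have [measurable]: "(\<lambda>v. emeasure lborel (row_section A v \<union> W)) \<in> borel_measurable borel"
    by (simp add: row_section_def Collect_disj_eq)
  have "{v \<in> space borel. 0 \<le> v \<and> ennreal p < emeasure lborel (row_section A v \<union> W) + ennreal (f v)}
      \<in> sets borel"
    by measurable
  then show ?thesis by (simp add: full_rows_def)
qed

text \<open>A point outside \<open>A\<close> and the new lines sees a row total at most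
  \<open>p\<close> and a column total at most \<open>q\<close>. Its pair of totals lies in
  \<open>ERect p q\<close>, hence in \<open>Z\<close>, so it is not infected. Testing columns
  against \<open>H'\<close> instead of \<open>H\<close> only enlarges the dominating set.\<close>

lemma ET_subset_lines:
  assumes Z: "ERect p q \<subseteq> Z" and pq: "p \<ge> 0" "q \<ge> 0"
    and f: "\<And>x. f x \<ge> 0" and g: "\<And>x. g x \<ge> 0"
    and A [measurable]: "A \<in> sets borel" and W [measurable]: "W \<in> sets borel"
    and H' [measurable]: "H' \<in> sets borel"
    and X: "X \<subseteq> A \<union> lines W H"
    and H'_def: "H' = H \<union> full_rows p A f W"
    and W'_def: "W' = W \<union> full_rows q (prod.swap -` A) g H'"
  shows "ET Z f g X \<subseteq> A \<union> lines W' H'"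
proof
  fix x assume x: "x \<in> ET Z f g X"
  obtain u v where uv: "x = (u, v)" by force
  show "x \<in> A \<union> lines W' H'"
  proof (rule ccontr)
    assume neg: "x \<notin> A \<union> lines W' H'"
    then have n: "(u, v) \<notin> A" "u \<notin> W'" "v \<notin> H'" by (auto simp: uv lines_def)
    then have "(u, v) \<notin> X" using X by (auto simp: lines_def W'_def H'_def)
    then have uv0: "0 \<le> u" "0 \<le> v" and notZ:
      "\<not> (Erow (u, v) X < \<infinity> \<and> Ecol (u, v) X < \<infinity> \<and>
         (enn2real (Erow (u, v) X) + f v, enn2real (Ecol (u, v) X) + g u) \<in> Z)"
      using x by (auto simp: ET_def uv)
    have sw [measurable]: "prod.swap -` A \<in> sets borel" by (rule borel_swap[OF A])
    have "Erow (u, v) X \<le> emeasure lborel (row_section A v \<union> W)"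
      unfolding Erow_def
    proof (rule emeasure_mono)
      show "{s. (s, snd (u, v)) \<in> X} \<subseteq> row_section A v \<union> W"
        using X n by (auto simp: row_section_def lines_def H'_def)
    qed simp
    moreover have "emeasure lborel (row_section A v \<union> W) + ennreal (f v) \<le> ennreal p"
      using n uv0 by (auto simp: H'_def full_rows_def)
    ultimately have r: "Erow (u, v) X + ennreal (f v) \<le> ennreal p"
      by (meson add_right_mono order_trans)
    have "Ecol (u, v) X \<le> emeasure lborel (row_section (prod.swap -` A) u \<union> H')"
      unfolding Ecol_def
    proof (rule emeasure_mono)
      show "{t. (fst (u, v), t) \<in> X} \<subseteq> row_section (prod.swap -` A) u \<union> H'"
        using X n by (auto simp: row_section_def lines_def H'_def W'_def)
    qed simp
    moreover have "emeasure lborel (row_section (prod.swap -` A) u \<union> H') + ennreal (g u) \<le> ennreal q"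
      using n uv0 by (auto simp: W'_def full_rows_def)
    ultimately have c: "Ecol (u, v) X + ennreal (g u) \<le> ennreal q"
      by (meson add_right_mono order_trans)
    have real: "e < \<infinity> \<and> enn2real e + y \<le> z" if "e + ennreal y \<le> ennreal z" "y \<ge> 0" "z \<ge> 0" for e y z
      using that by (cases e) (auto simp: top_unique simp flip: ennreal_plus)
    show False
      using real[OF r f pq(1)] real[OF c g pq(2)] notZ Z f[of v] g[of u]
      by (auto simp: ERect_def subset_iff)
  qed
qed

text \<open>If the bound failed, \<open>grow_rows_or_bound\<close> would preserve the invariant
  forever, keeping the measures of all \<open>W n\<close> and \<open>H n\<close> below
  \<open>p\<close> and \<open>q\<close>. Arbitrarily distant points would then never be reached,
  although spanning covers the whole quadrant.\<close>

lemma spans_rectangle_bound: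
  assumes sp: "E_spans A Z f g" and Z: "ERect p q \<subseteq> Z" and pq: "p \<ge> 0" "q \<ge> 0"
    and cA: "compact A"
    and f: "f \<in> borel_measurable borel" "\<And>x. f x \<ge> 0"
    and g: "g \<in> borel_measurable borel" "\<And>x. g x \<ge> 0"
  shows "rectangle_bound p q A f g"
proof (rule ccontr)
  assume nb: "\<not> rectangle_bound p q A f g"
  have A: "A \<in> sets borel" using cA by (simp add: compact_imp_closed)
  let ?A' = "prod.swap -` A"
  have A': "?A' \<in> sets borel" by (rule borel_swap[OF A])
  have nb': "\<not> rectangle_bound q p ?A' g f" using nb rectangle_bound_swap[OF A] by simp
  \<comment> \<open>One round fills rows first and then columns, tested against the enlarged rows;
    it dominates one application of \<open>ET\<close>.\<close>
  define step where "step = (\<lambda>(W, H). (W \<union> full_rows q ?A' g (H \<union> full_rows p A f W), H \<union> full_rows p A f W))"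
  define W where "W n = fst ((step ^^ n) ({}, {}))" for n
  define H where "H n = snd ((step ^^ n) ({}, {}))" for n
  have WH0: "W 0 = {}" "H 0 = {}" by (simp_all add: W_def H_def)
  have HS: "H (Suc n) = H n \<union> full_rows p A f (W n)" for n
    by (simp add: W_def H_def step_def case_prod_beta)
  have WS: "W (Suc n) = W n \<union> full_rows q ?A' g (H (Suc n))" for n
    unfolding HS by (simp add: W_def H_def step_def case_prod_beta)
  have inv: "line_state p q A f g (W n) (H n) \<and> (ET Z f g ^^ n) A \<subseteq> A \<union> lines (W n) (H n)" for n
  proof (induction n)
    case 0
    show ?case using pq by (simp add: WH0 line_state_def)
  next
    case (Suc n)
    then have st: "line_state p q A f g (W n) (H n)"
      and WB: "W n \<in> sets borel" and X: "(ET Z f g ^^ n) A \<subseteq> A \<union> lines (W n) (H n)"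
      unfolding line_state_def by blast+
    have st1: "line_state p q A f g (W n) (H (Suc n))"
      unfolding HS using A WB f
      by (intro grow_rows_or_bound st A f pq full_rows_borel nb)
         (auto simp: full_rows_def less_imp_le)
    then have HB: "H (Suc n) \<in> sets borel" unfolding line_state_def by blast
    have "line_state q p ?A' g f (H (Suc n)) (W (Suc n))"
      unfolding WS using A' HB g st1
      by (intro grow_rows_or_bound A' g pq full_rows_borel nb')
         (auto simp: full_rows_def less_imp_le line_state_swap[OF A, symmetric])
    then have "line_state p q A f g (W (Suc n)) (H (Suc n))"
      using line_state_swap[OF A] by blast
    moreover have "(ET Z f g ^^ Suc n) A \<subseteq> A \<union> lines (W (Suc n)) (H (Suc n))"
      unfolding funpow.simps comp_def
      by (rule ET_subset_lines[OF Z pq f(2) g(2) A WB HB X HS WS])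
    ultimately show ?case by blast
  qed
  \<comment> \<open>An increasing union of sets of measure at most \<open>c\<close> has measure at
    most \<open>c\<close>, so it cannot contain a half-line.\<close>
  have far: "\<exists>x>M. x \<notin> (\<Union>n. S n)"
    if S: "\<And>n. S n \<in> sets borel" "\<And>n. emeasure lborel (S n) \<le> ennreal c" "incseq S"
    for S :: "nat \<Rightarrow> real set" and c M
  proof (rule ccontr)
    assume "\<not> ?thesis"
    then have sub: "{M<..} \<subseteq> (\<Union>n. S n)" by auto
    have "emeasure lborel (\<Union>n. S n) = (SUP n. emeasure lborel (S n))"
      using S by (intro SUP_emeasure_incseq[symmetric]) auto
    also have "\<dots> \<le> ennreal c" using S by (intro SUP_least) auto
    finally have "emeasure lborel (\<Union>n. S n) \<le> ennreal c" .
    moreover have "emeasure lborel {M<..<M + (\<bar>c\<bar> + 1)} \<le> emeasure lborel (\<Union>n. S n)"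
      using S sub by (intro emeasure_mono) auto
    ultimately have "ennreal (\<bar>c\<bar> + 1) \<le> ennreal c" by simp
    then show False by (cases "c \<ge> 0") (auto simp: ennreal_neg)
  qed
  \<comment> \<open>Since \<open>A\<close> is bounded, a point with coordinates beyond
    \<open>M\<close> could only be reached through the lines.\<close>
  obtain M where M: "M > 0" "\<And>x. x \<in> A \<Longrightarrow> norm x \<le> M"
    using compact_imp_bounded[OF cA] unfolding bounded_pos by blast
  have "incseq W" "incseq H" by (auto intro!: incseq_SucI simp: WS HS)
  with inv obtain u v where u: "u > M" "u \<notin> (\<Union>n. W n)" and v: "v > M" "v \<notin> (\<Union>n. H n)"
    using far[of W p M] far[of H q M] unfolding line_state_def by blast
  have "(u, v) \<in> (\<Union>n. (ET Z f g ^^ n) A)"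
    using sp u v M(1) by (simp add: E_spans_def quadrant_def)
  then have "(u, v) \<in> A" using inv u(2) v(2) by (fastforce simp: lines_def)
  then have "\<bar>u\<bar> \<le> M" using M(2)[of "(u, v)"] norm_fst_le[of u v] by simp
  then show False using u(1) by simp
qed

subsection \<open>The cost of a spanning triple\<close>

text \<open>Admissibility says nothing about negative arguments. Constant continuation gives a
  nonincreasing, hence Borel, nonnegative function on the whole line, and \<open>ET\<close> reads
  only nonnegative coordinates.\<close>

abbreviation extend0 :: "(real \<Rightarrow> real) \<Rightarrow> real \<Rightarrow> real" where
  "extend0 f \<equiv> \<lambda>x. f (max 0 x)"

lemma admissible_extend0:
  assumes "admissible_fun f"
  shows "extend0 f \<in> borel_measurable borel" and "extend0 f x \<ge> 0"
proof -
  have "mono (\<lambda>x. - extend0 f x)"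
    using assms by (auto simp: mono_def admissible_fun_def)
  then have "(\<lambda>x. - extend0 f x) \<in> borel_measurable borel" by (rule borel_measurable_mono)
  then show "extend0 f \<in> borel_measurable borel" by simp
  show "extend0 f x \<ge> 0" using assms by (simp add: admissible_fun_def)
qed

lemma ET_extend0: "ET Z (extend0 f) (extend0 g) = ET Z f g"
  by (rule ext) (auto simp: ET_def)

text \<open>On the half-line an admissible function is bounded with bounded support, so the gauge
  integral in the cost agrees with the Lebesgue integral.\<close>

lemma admissible_integral:
  assumes f: "admissible_fun f"
  shows "(\<integral>\<^sup>+x\<in>{0..}. ennreal (extend0 f x) \<partial>lborel) = ennreal (integral {0..} f)"
    and "integral {0..} f \<ge> 0"
proof -
  obtain M where M: "\<And>x. x \<ge> M \<Longrightarrow> f x = 0"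
    using f unfolding admissible_fun_def by blast
  have nn: "extend0 f x \<ge> 0" for x by (rule admissible_extend0(2)[OF f])
  have ub: "extend0 f x \<le> f 0" for x using f by (simp add: admissible_fun_def)
  have "integrable lborel (\<lambda>x. indicator {0..\<bar>M\<bar>} x *\<^sub>R extend0 f x)"
  proof (rule integrableI_bounded_set_indicator)
    show "AE x in lborel. x \<in> {0..\<bar>M\<bar>} \<longrightarrow> norm (extend0 f x) \<le> f 0"
      using nn ub by (intro AE_I2 impI) (simp only: real_norm_def abs_of_nonneg)
  qed (use admissible_extend0(1)[OF f] in simp_all)
  moreover have "indicator {0..\<bar>M\<bar>} x *\<^sub>R extend0 f x = indicator {0..} x *\<^sub>R extend0 f x" for x :: real
    using M[of x] by (auto simp: indicator_def max_def)
  ultimately have int: "set_integrable lborel {0..} (extend0 f)"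
    unfolding set_integrable_def by (simp only:)
  have "(\<integral>\<^sup>+x\<in>{0..}. ennreal (extend0 f x) \<partial>lborel)
      = (\<integral>\<^sup>+x. ennreal (indicator {0..} x *\<^sub>R extend0 f x) \<partial>lborel)"
    by (intro nn_integral_cong) (auto simp: indicator_def)
  also have "\<dots> = ennreal (LINT x:{0..}|lborel. extend0 f x)"
    unfolding set_lebesgue_integral_def
    using int nn by (intro nn_integral_eq_integral) (auto simp: set_integrable_def)
  also have "(LINT x:{0..}|lborel. extend0 f x) = integral {0..} (extend0 f)"
    by (rule set_borel_integral_eq_integral(2)[OF int])
  also have eq: "integral {0..} (extend0 f) = integral {0..} f"
    by (intro integral_cong) auto
  finally show "(\<integral>\<^sup>+x\<in>{0..}. ennreal (extend0 f x) \<partial>lborel) = ennreal (integral {0..} f)" .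
  show "integral {0..} f \<ge> 0"
    unfolding eq[symmetric] by (intro integral_nonneg set_borel_integral_eq_integral(1)[OF int] nn)
qed

lemma nn_integral_min_le:
  assumes f: "admissible_fun f" and "S \<subseteq> {0..}"
  shows "(\<integral>\<^sup>+x\<in>S. ennreal (min (extend0 f x) p) \<partial>lborel) \<le> ennreal (integral {0..} f)"
  unfolding admissible_integral(1)[OF f, symmetric]
  using assms(2) by (intro nn_integral_mono) (auto simp: indicator_def intro!: ennreal_leI)

text \<open>The pointwise inequality is \<open>1\<^sub>S f + min f 1 \<le> f + 1\<^sub>S\<close>.\<close>
lemma nn_integral_min_add_le:
  assumes f: "admissible_fun f" and [measurable]: "S \<in> sets borel" "T \<in> sets borel"
    and ST: "S \<subseteq> {0..}" "T \<subseteq> {0..}" and S1: "emeasure lborel S \<le> 1"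
  shows "(\<integral>\<^sup>+x\<in>S. ennreal (min (extend0 f x) p) \<partial>lborel) + (\<integral>\<^sup>+x\<in>T. ennreal (min (extend0 f x) 1) \<partial>lborel)
    \<le> ennreal (integral {0..} f) + 1"
proof -
  note [measurable] = admissible_extend0(1)[OF f]
  have nn: "extend0 f x \<ge> 0" for x by (rule admissible_extend0(2)[OF f])
  have "ennreal (min (extend0 f x) p) * indicator S x + ennreal (min (extend0 f x) 1) * indicator T x
      \<le> ennreal (extend0 f x) * indicator {0..} x + indicator S x" for x
  proof -
    have 1: "ennreal (min (extend0 f x) 1) \<le> 1" "ennreal (min (extend0 f x) 1) \<le> ennreal (extend0 f x)"
      "ennreal (min (extend0 f x) p) \<le> ennreal (extend0 f x)"
      by (auto intro!: ennreal_leI simp flip: ennreal_1)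
    have 2: "x \<in> {0..}" if "x \<in> S \<or> x \<in> T" using ST that by blast
    show ?thesis
      using 1 2 by (cases "x \<in> S"; cases "x \<in> T") (auto intro: add_mono simp: add_increasing2)
  qed
  then have "(\<integral>\<^sup>+x\<in>S. ennreal (min (extend0 f x) p) \<partial>lborel) + (\<integral>\<^sup>+x\<in>T. ennreal (min (extend0 f x) 1) \<partial>lborel)
    \<le> (\<integral>\<^sup>+x. ennreal (extend0 f x) * indicator {0..} x + indicator S x \<partial>lborel)"
    by (subst nn_integral_add[symmetric]) (auto intro!: nn_integral_mono)
  also have "\<dots> = ennreal (integral {0..} f) + emeasure lborel S"
    unfolding admissible_integral(1)[OF f, symmetric] by (subst nn_integral_add) auto
  also have "\<dots> \<le> ennreal (integral {0..} f) + 1"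
    by (intro add_left_mono S1)
  finally show ?thesis .
qed

text \<open>The first bound drops the caps in the \<open>a\<close> by 1 rectangle. For the second,
  the two rectangles are added: each of \<open>f\<close> and \<open>g\<close> then appears once
  capped at \<open>a\<close> on a set of measure at most 1 and once capped at 1, which together cost
  at most its integral plus 1.\<close>

lemma spanning_cost_bounds:
  fixes a :: real
  defines "Z \<equiv> ERect a 1 \<union> ERect 1 a"
  assumes a: "a \<ge> 0" and sp: "E_spans A Z f g" and cA: "compact A"
    and f: "admissible_fun f" and g: "admissible_fun g"
  shows "a \<le> measure lborel A + integral {0..} f + integral {0..} g"
    and "2 * a \<le> 2 * measure lborel A + integral {0..} f + integral {0..} g + 2"
proof -
  let ?f = "extend0 f" and ?g = "extend0 g"
  let ?F = "integral {0..} f" and ?G = "integral {0..} g" and ?m = "measure lborel A"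
  note fm = admissible_extend0[OF f] and gm = admissible_extend0[OF g]
  have nn: "?F \<ge> 0" "?G \<ge> 0" "?m \<ge> 0" by (simp_all add: admissible_integral(2) f g)
  have sp': "E_spans A Z ?f ?g" using sp by (simp add: E_spans_def ET_extend0)
  have eA: "emeasure lborel A = ennreal ?m"
    using emeasure_compact_finite[OF cA] by (intro emeasure_eq_ennreal_measure) auto
  have "rectangle_bound a 1 A ?f ?g"
    using a by (intro spans_rectangle_bound[OF sp'] cA fm gm) (auto simp: Z_def)
  then obtain W1 H1 where b1: "W1 \<in> sets borel" "H1 \<in> sets borel" "W1 \<subseteq> {0..}" "H1 \<subseteq> {0..}"
      "emeasure lborel H1 \<le> ennreal 1"
      "ennreal (a * 1) \<le> emeasure lborel A
       + ((\<integral>\<^sup>+x\<in>H1. ennreal (min (?f x) a) \<partial>lborel) + (\<integral>\<^sup>+x\<in>W1. ennreal (min (?g x) 1) \<partial>lborel))"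
    unfolding rectangle_bound_def by (elim exE conjE) (rule that)
  have "rectangle_bound 1 a A ?f ?g"
    using a by (intro spans_rectangle_bound[OF sp'] cA fm gm) (auto simp: Z_def)
  then obtain W2 H2 where b2: "W2 \<in> sets borel" "H2 \<in> sets borel" "W2 \<subseteq> {0..}" "H2 \<subseteq> {0..}"
      "emeasure lborel W2 \<le> ennreal 1"
      "ennreal (1 * a) \<le> emeasure lborel A
       + ((\<integral>\<^sup>+x\<in>H2. ennreal (min (?f x) 1) \<partial>lborel) + (\<integral>\<^sup>+x\<in>W2. ennreal (min (?g x) a) \<partial>lborel))"
    unfolding rectangle_bound_def by (elim exE conjE) (rule that)
  have "ennreal a \<le> ennreal ?m + (ennreal ?F + ennreal ?G)"
    using b1(6) unfolding eA mult_1_right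
    by (rule order_trans) (intro add_mono order_refl nn_integral_min_le f g b1)
  then show "a \<le> ?m + ?F + ?G" using nn by (simp flip: ennreal_plus)
  have "ennreal a + ennreal a \<le>
      (ennreal ?m + ((\<integral>\<^sup>+x\<in>H1. ennreal (min (?f x) a) \<partial>lborel) + (\<integral>\<^sup>+x\<in>W1. ennreal (min (?g x) 1) \<partial>lborel)))
      + (ennreal ?m + ((\<integral>\<^sup>+x\<in>H2. ennreal (min (?f x) 1) \<partial>lborel) + (\<integral>\<^sup>+x\<in>W2. ennreal (min (?g x) a) \<partial>lborel)))"
    using add_mono[OF b1(6) b2(6)] unfolding eA mult_1_right mult_1_left .
  also have "\<dots> = (ennreal ?m + ennreal ?m) +
      (((\<integral>\<^sup>+x\<in>H1. ennreal (min (?f x) a) \<partial>lborel) + (\<integral>\<^sup>+x\<in>H2. ennreal (min (?f x) 1) \<partial>lborel))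
      + ((\<integral>\<^sup>+x\<in>W2. ennreal (min (?g x) a) \<partial>lborel) + (\<integral>\<^sup>+x\<in>W1. ennreal (min (?g x) 1) \<partial>lborel)))"
    by (simp only: ac_simps)
  also have "\<dots> \<le> (ennreal ?m + ennreal ?m) + ((ennreal ?F + 1) + (ennreal ?G + 1))"
    using b1(5) b2(5) by (intro add_mono order_refl nn_integral_min_add_le f g b1 b2) simp_all
  also have "\<dots> = ennreal (2 * ?m + ?F + ?G + 2)"
    using nn by (simp flip: ennreal_plus ennreal_1)
  finally have "ennreal (2 * a) \<le> ennreal (2 * ?m + ?F + ?G + 2)"
    using a by (simp flip: ennreal_plus)
  then show "2 * a \<le> 2 * ?m + ?F + ?G + 2" using nn by (subst (asm) ennreal_le_iff) simp_all
qed

lemma spanning_cost_ge: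
  fixes a :: nat
  assumes \<alpha>: "0 < \<alpha>" "\<alpha> < 1"
    and sp: "E_spans A (ERect (real a) 1 \<union> ERect 1 (real a)) f g" and cA: "compact A"
    and f: "admissible_fun f" and g: "admissible_fun g"
  shows "real a - 2 * \<alpha> - 9 * real a * \<alpha> powr (3/2)
     \<le> measure lborel A + (1 - \<alpha>) * integral {0..} f + (1 - \<alpha>) * integral {0..} g"
proof -
  let ?S = "integral {0..} f + integral {0..} g" and ?m = "measure lborel A"
  have nn: "?S \<ge> 0" "?m \<ge> 0" by (simp_all add: admissible_integral(2) f g)
  have cost: "?m + (1 - \<alpha>) * integral {0..} f + (1 - \<alpha>) * integral {0..} g = ?m + (1 - \<alpha>) * ?S"
    by (simp add: algebra_simps)
  show ?thesis
  proof (cases "\<alpha> \<le> 1/2")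
    case True
    have "a \<le> ?m + ?S" "2 * a \<le> 2 * ?m + ?S + 2"
      using spanning_cost_bounds[OF _ sp cA f g] by simp_all
    \<comment> \<open>These weights give coefficient 1 to the area and \<open>1 - \<alpha>\<close>
      to the integrals; the first is nonnegative exactly when
      \<open>\<alpha> \<le> 1/2\<close>.\<close>
    then have "(1 - 2 * \<alpha>) * a \<le> (1 - 2 * \<alpha>) * (?m + ?S)" "\<alpha> * (2 * a) \<le> \<alpha> * (2 * ?m + ?S + 2)"
      using True \<alpha> by (intro mult_left_mono; simp)+
    then have "real a - 2 * \<alpha> \<le> ?m + (1 - \<alpha>) * ?S" by (simp add: algebra_simps)
    moreover have "9 * real a * \<alpha> powr (3/2) \<ge> 0" by simp
    ultimately show ?thesis unfolding cost by linarith
  next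
    case False
    \<comment> \<open>Here the error term is at least \<open>9 * a / 4\<close>, which exceeds
      \<open>a\<close>, so the claimed bound is nonpositive while the cost is nonnegative.\<close>
    have "1/4 \<le> (1/2 :: real) powr 2" by (simp add: power2_eq_square)
    also have "\<dots> \<le> (1/2) powr (3/2)" by (intro powr_mono') auto
    also have "\<dots> \<le> \<alpha> powr (3/2)" using False by (intro powr_mono2) auto
    finally have "9 * real a * (1/4) \<le> 9 * real a * \<alpha> powr (3/2)" by (intro mult_left_mono) auto
    then have "real a - 2 * \<alpha> - 9 * real a * \<alpha> powr (3/2) \<le> 0" using \<alpha> by simp
    also have "\<dots> \<le> ?m + (1 - \<alpha>) * ?S" using mult_nonneg_nonneg[of "1 - \<alpha>" ?S] nn \<alpha> by simp
    finally show ?thesis unfolding cost .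
  qed
qed

subsection \<open>A cheap spanning triple\<close>

text \<open>Including \<open>x = k\<close> gives left-continuity. Taking \<open>k > 1\<close> pushes
  the relevant totals strictly beyond the boundary of the closed zero-set.\<close>

definition plateau :: "real \<Rightarrow> real \<Rightarrow> real" where
  "plateau k x = (if x \<le> k then k else 0)"

text \<open>Index 0 is left out: over \<open>[0, k]\<close> the plateaus do the work of a
  block.\<close>

definition diagonal_blocks :: "real \<Rightarrow> nat \<Rightarrow> pt set" where
  "diagonal_blocks k n = (\<Union>i\<in>{1..n}. {k * real i..k * (real i + 1)} \<times> {k * real i..k * (real i + 1)})"

text \<open>Lower bounds for \<open>Erow\<close> and \<open>Ecol\<close> of the iterates rest on
  measurable sections, because \<open>emeasure\<close> is 0 off the sigma-algebra.\<close>

lemma ET_borel: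
  assumes B: "B \<in> sets borel" and Z: "Z \<in> sets borel"
    and f: "admissible_fun f" and g: "admissible_fun g"
  shows "ET Z f g B \<in> sets borel"
proof -
  define R where "R v = emeasure lborel (row_section B v)" for v
  define C where "C u = emeasure lborel (row_section (prod.swap -` B) u)" for u
  define \<phi> where "\<phi> x = (enn2real (R (snd x)) + extend0 f (snd x), enn2real (C (fst x)) + extend0 g (fst x))"
    for x :: pt
  have RC: "R \<in> borel_measurable borel" "C \<in> borel_measurable borel"
    unfolding R_def C_def using B borel_swap[OF B] by (auto intro: emeasure_lborel_rows(2))
  have pr [measurable]: "(fst :: pt \<Rightarrow> real) \<in> borel_measurable borel" "(snd :: pt \<Rightarrow> real) \<in> borel_measurable borel"
    by (intro borel_measurable_continuous_onI continuous_intros)+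
  have fs: "(\<lambda>x::pt. extend0 f (snd x)) \<in> borel_measurable borel"
    by (rule measurable_compose[OF pr(2) admissible_extend0(1)[OF f]])
  have gs: "(\<lambda>x::pt. extend0 g (fst x)) \<in> borel_measurable borel"
    by (rule measurable_compose[OF pr(1) admissible_extend0(1)[OF g]])
  have "(\<lambda>x::pt. R (snd x)) \<in> borel_measurable borel" "(\<lambda>x::pt. C (fst x)) \<in> borel_measurable borel"
    by (rule measurable_compose[OF pr(2) RC(1)], rule measurable_compose[OF pr(1) RC(2)])
  note [measurable] = fs gs this
  have [measurable]: "\<phi> \<in> borel_measurable borel"
    unfolding \<phi>_def by (intro borel_measurable_Pair) measurable
  note [measurable] = Z
  have "{x \<in> space borel. 0 \<le> fst x \<and> 0 \<le> snd x \<and> \<not> (R (snd x) < \<infinity> \<and> C (fst x) < \<infinity> \<and> \<phi> x \<in> Z)} \<in> sets borel"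
    by measurable
  moreover have "ET Z f g B = B \<union> {x \<in> space borel. 0 \<le> fst x \<and> 0 \<le> snd x \<and>
      \<not> (R (snd x) < \<infinity> \<and> C (fst x) < \<infinity> \<and> \<phi> x \<in> Z)}"
    by (auto simp: ET_def R_def C_def \<phi>_def Erow_def Ecol_def row_section_def)
  ultimately show ?thesis using B by simp
qed

text \<open>Only lower bounds for the totals are at hand, so \<open>big\<close> asks that every
  larger pair avoids \<open>Z\<close>. An infinite row or column infects outright.\<close>

lemma ET_infectI:
  assumes "0 \<le> u" "0 \<le> v" "ennreal r \<le> Erow (u, v) B" "ennreal c \<le> Ecol (u, v) B" "0 \<le> r" "0 \<le> c"
    and big: "\<And>x y. r + f v \<le> x \<Longrightarrow> c + g u \<le> y \<Longrightarrow> (x, y) \<notin> Z"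
  shows "(u, v) \<in> ET Z f g B"
proof -
  have "y \<le> enn2real e" if "ennreal y \<le> e" "e < \<infinity>" "0 \<le> y" for y e
    using that by (cases e) auto
  then show ?thesis using assms unfolding ET_def by auto
qed

lemma Erow_ge_interval:
  assumes B: "B \<in> sets borel" and "i \<le> j" and "\<And>s. i \<le> s \<Longrightarrow> s \<le> j \<Longrightarrow> (s, v) \<in> B"
  shows "ennreal (j - i) \<le> Erow (u, v) B"
proof -
  have "emeasure lborel {i..j} \<le> emeasure lborel (row_section B v)"
    using assms by (intro emeasure_mono) (auto simp: row_section_def)
  then show ?thesis using assms(2) by (simp add: Erow_def row_section_def)
qed

lemma Ecol_ge_interval:
  assumes B: "B \<in> sets borel" and "i \<le> j" and "\<And>t. i \<le> t \<Longrightarrow> t \<le> j \<Longrightarrow> (u, t) \<in> B"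
  shows "ennreal (j - i) \<le> Ecol (u, v) B"
  using Erow_ge_interval[OF borel_swap[OF B], of i j u v] assms
  by (simp add: Erow_def Ecol_def)

section \<open>Admissibility and cost of the plateau and the blocks\<close>

lemma plateau_admissible:
  assumes "k \<ge> 0"
  shows "admissible_fun (plateau k)"
proof -
  have "(plateau k \<longlongrightarrow> plateau k x) (at_left x)" if "x > 0" for x
  proof (rule tendsto_eventually, cases "x \<le> k")
    case True
    have "\<forall>\<^sub>F y in at_left x. y \<in> {x - 1<..<x}" by (rule eventually_at_left_real) simp
    then show "\<forall>\<^sub>F y in at_left x. plateau k y = plateau k x"
      by eventually_elim (use True in \<open>auto simp: plateau_def\<close>)
  next
    case False
    then have "\<forall>\<^sub>F y in at_left x. y \<in> {k<..<x}" by (intro eventually_at_left_real) simp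
    then show "\<forall>\<^sub>F y in at_left x. plateau k y = plateau k x"
      by eventually_elim (use False in \<open>auto simp: plateau_def\<close>)
  qed
  moreover have "\<exists>M. \<forall>x\<ge>M. plateau k x = 0" by (intro exI[of _ "k + 1"]) (auto simp: plateau_def)
  moreover have "\<forall>x\<ge>0. plateau k x \<ge> 0" "\<forall>x y. 0 \<le> x \<longrightarrow> x \<le> y \<longrightarrow> plateau k y \<le> plateau k x"
    using assms by (auto simp: plateau_def)
  ultimately show ?thesis unfolding admissible_fun_def by blast
qed

lemma plateau_integral:
  assumes "k \<ge> 0"
  shows "integral {0..} (plateau k) = k\<^sup>2"
proof -
  have "((\<lambda>x. k) has_integral k * k) {0..k}"
    using has_integral_const_real[of k 0 k] assms by simp
  then have "((\<lambda>x. if x \<in> {0..k} then k else 0) has_integral k * k) {0..}"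
    by (subst has_integral_restrict) auto
  then have "(plateau k has_integral k * k) {0..}"
    by (rule has_integral_eq[rotated]) (auto simp: plateau_def)
  then show ?thesis by (simp add: integral_unique power2_eq_square)
qed

lemma diagonal_blocks_compact: "compact (diagonal_blocks k n)"
  unfolding diagonal_blocks_def by (intro compact_UN compact_Times) auto

text \<open>Consecutive blocks share a corner; subadditivity suffices for an upper bound.\<close>

lemma diagonal_blocks_area:
  assumes "k \<ge> 0"
  shows "measure lborel (diagonal_blocks k n) \<le> real n * k\<^sup>2"
proof -
  let ?I = "\<lambda>i::nat. {k * real i..k * (real i + 1)}"
  have e: "emeasure lborel (?I i \<times> ?I i) = ennreal (k\<^sup>2)" for i
  proof -
    have "emeasure lborel (?I i \<times> ?I i) = emeasure lborel (?I i) * emeasure lborel (?I i)"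
      unfolding lborel_prod[symmetric] by (intro lborel.emeasure_pair_measure_Times) auto
    also have "\<dots> = ennreal (k\<^sup>2)"
      using assms by (simp add: algebra_simps power2_eq_square ennreal_mult)
    finally show ?thesis .
  qed
  have "emeasure lborel (diagonal_blocks k n) \<le> (\<Sum>i\<in>{1..n}. emeasure lborel (?I i \<times> ?I i))"
    unfolding diagonal_blocks_def
    by (intro emeasure_subadditive_finite) (auto intro!: borel_closed closed_Times)
  also have "\<dots> = ennreal (real n * k\<^sup>2)"
    unfolding e by (simp add: ennreal_mult ennreal_of_nat_eq_real_of_nat)
  finally have "emeasure lborel (diagonal_blocks k n) \<le> ennreal (real n * k\<^sup>2)" .
  then show ?thesis unfolding measure_def by (intro enn2real_leI) auto
qed

lemma block_index:
  assumes k: "k > 0" and x: "k < x" "x \<le> k * (real n + 1)"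
  obtains i where "i \<in> {1..n}" "k * real i \<le> x" "x \<le> k * (real i + 1)"
proof -
  \<comment> \<open>The ceiling, not the floor, puts the right endpoint \<open>k * (n + 1)\<close>
    into block \<open>n\<close>; \<open>x > k\<close> makes the index at least 1.\<close>
  define i where "i = nat (\<lceil>x / k\<rceil> - 1)"
  have 1: "1 < x / k" "x / k \<le> real n + 1" using k x by (simp_all add: field_simps)
  then have "\<lceil>x / k\<rceil> \<ge> 2" "\<lceil>x / k\<rceil> \<le> int n + 1" by linarith+
  moreover from this have "real i = of_int \<lceil>x / k\<rceil> - 1" by (simp add: i_def)
  moreover from this have "real i \<le> x / k" "x / k \<le> real i + 1" by linarith+
  then have "k * real i \<le> x" "x \<le> k * (real i + 1)" using k by (simp_all add: field_simps)
  moreover have "i \<in> {1..n}" using calculation(1,2) unfolding i_def atLeastAtMost_iff by linarith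
  ultimately show ?thesis using that by blast
qed

text \<open>Three waves. In the square of side \<open>k * (n + 1)\<close> each row and each column
  gains \<open>k > 1\<close> from a plateau or a block. In the strips of width \<open>k\<close>
  along the axes, that side plus the plateau exceeds \<open>a\<close>. Afterwards every point sees
  at least \<open>k\<close> in both directions.\<close>

lemma diagonal_blocks_span:
  fixes n :: nat
  assumes k: "k > 1"
  defines "a \<equiv> real n + 2"
  defines "Z \<equiv> ERect a 1 \<union> ERect 1 a"
  shows "E_spans (diagonal_blocks k n) Z (plateau k) (plateau k)"
proof -
  let ?A = "diagonal_blocks k n" and ?p = "plateau k"
  let ?T = "ET Z ?p ?p"
  have adm: "admissible_fun ?p" using k by (intro plateau_admissible) simp
  have Zb: "Z \<in> sets borel"
    unfolding Z_def ERect_def by (intro borel_closed closed_Un closed_Times) auto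
  have A0: "?A \<in> sets borel" by (intro borel_closed compact_imp_closed diagonal_blocks_compact)
  have A1: "?T ?A \<in> sets borel" and A2: "?T (?T ?A) \<in> sets borel"
    by (intro ET_borel A0 Zb adm)+
  have notZ: "(x, y) \<notin> Z" if "a < x \<or> a < y \<or> (1 < x \<and> 1 < y)" for x y
    using that by (auto simp: Z_def ERect_def a_def)
  let ?s = "k * (real n + 1)"
  have row: "\<exists>r\<ge>0. ennreal r \<le> Erow (u, v) ?A \<and> 1 < r + ?p v" if v: "0 \<le> v" "v \<le> ?s" for u v
  proof (cases "v \<le> k")
    case True
    then show ?thesis using k by (intro exI[of _ 0]) (simp add: plateau_def)
  next
    case False
    then obtain i where i: "i \<in> {1..n}" "k * real i \<le> v" "v \<le> k * (real i + 1)"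
      using block_index[of k v n] v k by auto
    have "ennreal (k * (real i + 1) - k * real i) \<le> Erow (u, v) ?A"
      using i k by (intro Erow_ge_interval A0) (auto simp: diagonal_blocks_def algebra_simps)
    then show ?thesis
      using k False by (intro exI[of _ k]) (simp add: plateau_def algebra_simps)
  qed
  have col: "\<exists>c\<ge>0. ennreal c \<le> Ecol (u, v) ?A \<and> 1 < c + ?p u" if u: "0 \<le> u" "u \<le> ?s" for u v
  proof -
    have "prod.swap -` ?A = ?A" by (auto simp: diagonal_blocks_def)
    then have "(t, u) \<in> ?A \<longleftrightarrow> (u, t) \<in> ?A" for t by (auto simp: set_eq_iff)
    then have "Ecol (u, v) ?A = Erow (v, u) ?A" by (simp add: Erow_def Ecol_def)
    then show ?thesis using row[OF u] by simp
  qed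
  have 1: "(u, v) \<in> ?T ?A" if uv: "0 \<le> u" "u \<le> ?s" "0 \<le> v" "v \<le> ?s" for u v
  proof -
    obtain r c where "0 \<le> r" "ennreal r \<le> Erow (u, v) ?A" "1 < r + ?p v"
      "0 \<le> c" "ennreal c \<le> Ecol (u, v) ?A" "1 < c + ?p u"
      using row[OF uv(3,4)] col[OF uv(1,2)] by blast
    then show ?thesis using uv by (intro ET_infectI[of u v r _ c] notZ) auto
  qed
  have ks: "k \<le> ?s" "0 \<le> ?s" using k by (simp_all add: algebra_simps)
  \<comment> \<open>The sum is \<open>k * (n + 2)\<close>, that is \<open>k * a\<close>.\<close>
  have big: "a < ?s + k" using k mult_strict_right_mono[of 1 k "real n + 2"]
    by (simp add: a_def algebra_simps)
  have 2: "(u, v) \<in> ?T (?T ?A)" if uv: "0 \<le> u" "0 \<le> v" and *: "u \<le> k \<or> v \<le> k" for u v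
  proof (cases "v \<le> k")
    case True
    have "ennreal (?s - 0) \<le> Erow (u, v) (?T ?A)"
      using True uv ks by (intro Erow_ge_interval A1 1) auto
    then show ?thesis using True uv ks big
      by (intro ET_infectI[of u v ?s _ 0] notZ) (auto simp: plateau_def)
  next
    case False
    then have "u \<le> k" using * by simp
    moreover have "ennreal (?s - 0) \<le> Ecol (u, v) (?T ?A)"
      using \<open>u \<le> k\<close> uv ks by (intro Ecol_ge_interval A1 1) auto
    ultimately show ?thesis using uv ks big
      by (intro ET_infectI[of u v 0 _ ?s] notZ) (auto simp: plateau_def)
  qed
  have 3: "(u, v) \<in> (?T ^^ 3) ?A" if uv: "0 \<le> u" "0 \<le> v" for u v
  proof -
    have "0 \<le> ?p x" for x using k by (simp add: plateau_def)
    note pos = this[of u] this[of v]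
    have "ennreal (k - 0) \<le> Erow (u, v) (?T (?T ?A))" "ennreal (k - 0) \<le> Ecol (u, v) (?T (?T ?A))"
      using uv k by (intro Erow_ge_interval Ecol_ge_interval A2 2; simp)+
    then have "(u, v) \<in> ?T (?T (?T ?A))"
      using uv k pos by (intro ET_infectI[of u v k _ k] notZ) auto
    then show ?thesis by (simp add: numeral_3_eq_3)
  qed
  have "(?T ^^ m) ?A \<subseteq> quadrant" for m
  proof (induction m)
    case 0
    have "{k * real i..k * (real i + 1)} \<subseteq> {0..}" for i using k by simp
    then show ?case unfolding diagonal_blocks_def quadrant_def by (simp add: UN_least Sigma_mono)
  next
    case (Suc m)
    then show ?case by (auto simp: ET_def quadrant_def)
  qed
  moreover have "quadrant \<subseteq> (?T ^^ 3) ?A" using 3 by (auto simp: quadrant_def)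
  ultimately show ?thesis unfolding E_spans_def by blast
qed

section \<open>Both bounds for the infimum\<close>

theorem mainTheorem16:
  fixes a :: nat and \<alpha> :: real
  assumes "a \<ge> 3" and "0 < \<alpha>" and "\<alpha> < 1"
  shows "real a - 2 * \<alpha> - 9 * real a * \<alpha> powr (3/2)
           \<le> E_I \<alpha> \<alpha> (ERect (real a) 1 \<union> ERect 1 (real a))
       \<and> E_I \<alpha> \<alpha> (ERect (real a) 1 \<union> ERect 1 (real a)) \<le> real a - 2 * \<alpha>"
proof -
  let ?Z = "ERect (real a) 1 \<union> ERect 1 (real a)"
  define S where "S = {measure lborel A + (1 - \<alpha>) * integral {0..} f + (1 - \<alpha>) * integral {0..} g
      | A f g. compact A \<and> A \<subseteq> quadrant \<and> admissible_fun f \<and> admissible_fun g \<and> E_spans A ?Z f g}"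
  have EI: "E_I \<alpha> \<alpha> ?Z = Inf S" by (simp add: E_I_def S_def)
  have lower: "real a - 2 * \<alpha> - 9 * real a * \<alpha> powr (3/2) \<le> x" if "x \<in> S" for x
    using that spanning_cost_ge[OF assms(2,3)] unfolding S_def by blast
  \<comment> \<open>The blocks and the two plateaus scale with \<open>k\<close>, so their cost is at
    most \<open>k\<^sup>2\<close> times the target value.\<close>
  have wit: "\<exists>x\<in>S. x \<le> k\<^sup>2 * (real a - 2 * \<alpha>)" if k: "k > 1" for k
  proof
    let ?A = "diagonal_blocks k (a - 2)"
    let ?x = "measure lborel ?A + (1 - \<alpha>) * integral {0..} (plateau k) + (1 - \<alpha>) * integral {0..} (plateau k)"
    have a2: "real (a - 2) + 2 = real a" using assms(1) by simp
    have sp: "E_spans ?A ?Z (plateau k) (plateau k)"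
      using diagonal_blocks_span[OF k, of "a - 2"] unfolding a2 .
    \<comment> \<open>The zeroth iterate is the set itself, so spanning already places it in the
      quadrant.\<close>
    then have "(ET ?Z (plateau k) (plateau k) ^^ 0) ?A \<subseteq> quadrant"
      unfolding E_spans_def by blast
    then show "?x \<in> S"
      unfolding S_def mem_Collect_eq using sp k
      by (intro exI[of _ ?A] exI[of _ "plateau k"] conjI refl plateau_admissible diagonal_blocks_compact) simp_all
    have "?x \<le> real (a - 2) * k\<^sup>2 + (1 - \<alpha>) * k\<^sup>2 + (1 - \<alpha>) * k\<^sup>2"
      using diagonal_blocks_area[of k "a - 2"] k by (simp add: plateau_integral)
    also have "\<dots> = k\<^sup>2 * (real (a - 2) + 2 - 2 * \<alpha>)" by (simp add: algebra_simps)
    finally show "?x \<le> k\<^sup>2 * (real a - 2 * \<alpha>)" unfolding a2 .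
  qed
  have "bdd_below S" using lower by (rule bdd_belowI)
  then have upper: "Inf S \<le> k\<^sup>2 * (real a - 2 * \<alpha>)" if "k > 1" for k
    using wit[OF that] by (meson cInf_lower order_trans)
  \<comment> \<open>The target value is only approached from \<open>k > 1\<close>; the infimum
    absorbs the limit.\<close>
  have "((\<lambda>k. k\<^sup>2 * (real a - 2 * \<alpha>)) \<longlongrightarrow> 1\<^sup>2 * (real a - 2 * \<alpha>)) (at_right 1)"
    by (intro tendsto_intros)
  moreover have "\<forall>\<^sub>F k in at_right 1. Inf S \<le> k\<^sup>2 * (real a - 2 * \<alpha>)"
    using upper by (auto simp: eventually_at_right_field intro!: exI[of _ 2])
  ultimately have "Inf S \<le> 1\<^sup>2 * (real a - 2 * \<alpha>)"
    by (rule tendsto_lowerbound) simp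
  moreover have "S \<noteq> {}" using wit[of 2] by auto
  then have "real a - 2 * \<alpha> - 9 * real a * \<alpha> powr (3/2) \<le> Inf S"
    using lower by (rule cInf_greatest)
  ultimately show ?thesis unfolding EI by simp
qed

end
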